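(* Let $G$ be a profinite group and let $w$ be a word such that $|w\{G\}|<2^{\aleph_0}$. Suppose that $G$ has a subgroup $H$ that is equationally Noetherian (as an abstract group) and is dense in $G$ with respect to the profinite topology of $G$. Then $w\{G\}$ is finite.
   Context: A word $w$ in $k$ variables is an element of the free group on $k$ generators; for a group $G$ it defines by substitution a map $w\colon G^k\to G$, and $w\{G\}=\{w(g_1,\dots,g_k)\mid g_i\in G\}$ is the set of $w$-values. Let $H$ be any group and $F_k=F(x_1,\dots,x_k)$ the free group on $k$ variables. Each element $v$ of the free product $H*F_k$ defines by substitution (fixing the constants from $H$) a map $v\colon H^k\to H$. The verbal topology on $H^k$ is the topology whose sub-basis for the closed sets consists of the solution sets $V_H(S)=\{(h_1,\dots,h_k)\in H^k\mid v(h_1,\dots,h_k)=1 \text{ for all } v\in S\}$, where $S\subseteq H*F_k$. The group $H$ is equationally Noetherian if, for all $k$, every descending chain of verbally closed subsets of $H^k$ stabilizes. The profinite topology of the profinite group $G$ means its given topology. *)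

theory Defs
  imports "HOL-Analysis.Analysis" "HOL-Algebra.Group"
begin

section \<open>Monoids given by generators and relations\<close>

inductive_set word_cong :: "'x set \<Rightarrow> ('x list \<times> 'x list) set \<Rightarrow> ('x list \<times> 'x list) set"
  for A :: "'x set" and R :: "('x list \<times> 'x list) set"
where
  refl: "u \<in> lists A \<Longrightarrow> (u, u) \<in> word_cong A R"
| rel: "(l, r) \<in> R \<Longrightarrow> l \<in> lists A \<Longrightarrow> r \<in> lists A \<Longrightarrow> u \<in> lists A \<Longrightarrow> v \<in> lists A
    \<Longrightarrow> (u @ l @ v, u @ r @ v) \<in> word_cong A R"
| sym: "(u, v) \<in> word_cong A R \<Longrightarrow> (v, u) \<in> word_cong A R"
| trans: "(u, v) \<in> word_cong A R \<Longrightarrow> (v, z) \<in> word_cong A R \<Longrightarrow> (u, z) \<in> word_cong A R"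

definition presented_monoid :: "'x set \<Rightarrow> ('x list \<times> 'x list) set \<Rightarrow> 'x list set monoid" where
  "presented_monoid A R =
    \<lparr>carrier = lists A // word_cong A R,
     mult = (\<lambda>X Y. \<Union>x\<in>X. \<Union>y\<in>Y. word_cong A R `` {x @ y}),
     one = word_cong A R `` {[]}\<rparr>"

definition word_prod :: "('a, 'm) monoid_scheme \<Rightarrow> ('x \<Rightarrow> 'a) \<Rightarrow> 'x list \<Rightarrow> 'a" where
  "word_prod G f u = foldr (\<lambda>x y. f x \<otimes>\<^bsub>G\<^esub> y) u \<one>\<^bsub>G\<^esub>"

text \<open>If \<open>f\<close> respects the relations, then \<open>word_prod G f\<close> is constant on every class \<open>X\<close>
  (lemma \<open>presented_eval_class\<close> below), so that \<open>the_elem\<close> picks the common value.\<close>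

definition presented_eval :: "('a, 'm) monoid_scheme \<Rightarrow> ('x \<Rightarrow> 'a) \<Rightarrow> 'x list set \<Rightarrow> 'a" where
  "presented_eval G f X = the_elem (word_prod G f ` X)"

lemma word_cong_in_lists:
  assumes "(u, v) \<in> word_cong A R"
  shows "u \<in> lists A \<and> v \<in> lists A"
  using assms by induction auto

lemma equiv_word_cong: "equiv (lists A) (word_cong A R)"
proof (rule equivI)
  show "word_cong A R \<subseteq> lists A \<times> lists A"
    using word_cong_in_lists by fastforce
  show "refl_on (lists A) (word_cong A R)"
    by (auto intro!: refl_onI word_cong.refl)
  show "sym (word_cong A R)" by (blast intro: symI word_cong.sym)
  show "Relation.trans (word_cong A R)" by (blast intro: transI word_cong.trans)
qed

lemma word_cong_append_left:
  assumes "(u, v) \<in> word_cong A R" "z \<in> lists A"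
  shows "(z @ u, z @ v) \<in> word_cong A R"
  using assms
proof (induction)
  case (rel l r u v)
  then show ?case using word_cong.rel[of l r R A "z @ u" v] by simp
next
  case (refl u)
  then show ?case by (intro word_cong.refl) simp
next
  case (sym u v)
  then show ?case using word_cong.sym by blast
next
  case (trans u v x)
  then show ?case using word_cong.trans by blast
qed

lemma word_cong_append_right:
  assumes "(u, v) \<in> word_cong A R" "z \<in> lists A"
  shows "(u @ z, v @ z) \<in> word_cong A R"
  using assms
proof (induction)
  case (rel l r u v)
  then show ?case using word_cong.rel[of l r R A u "v @ z"] by simp
next
  case (refl u)
  then show ?case by (intro word_cong.refl) simp
next
  case (sym u v)
  then show ?case using word_cong.sym by blast
next
  case (trans u v x)
  then show ?case using word_cong.trans by blast
qed

lemma word_cong_append: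
  assumes "(u, u') \<in> word_cong A R" "(v, v') \<in> word_cong A R"
  shows "(u @ v, u' @ v') \<in> word_cong A R"
proof (rule word_cong.trans)
  show "(u @ v, u' @ v) \<in> word_cong A R"
    using assms word_cong_in_lists by (blast intro: word_cong_append_right)
  show "(u' @ v, u' @ v') \<in> word_cong A R"
    using assms word_cong_in_lists by (blast intro: word_cong_append_left)
qed

lemma presented_mult_class:
  assumes "u \<in> lists A" "v \<in> lists A"
  shows "word_cong A R `` {u} \<otimes>\<^bsub>presented_monoid A R\<^esub> word_cong A R `` {v}
    = word_cong A R `` {u @ v}"
proof -
  have "word_cong A R `` {x @ y} = word_cong A R `` {u @ v}"
    if "(u, x) \<in> word_cong A R" "(v, y) \<in> word_cong A R" for x y
    by (rule equiv_class_eq[OF equiv_word_cong word_cong_append[OF that], symmetric])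
  moreover have "(u, u) \<in> word_cong A R" "(v, v) \<in> word_cong A R"
    by (rule word_cong.refl[OF assms(1)], rule word_cong.refl[OF assms(2)])
  ultimately have "(\<Union>x\<in>word_cong A R `` {u}. \<Union>y\<in>word_cong A R `` {v}. word_cong A R `` {x @ y})
      = word_cong A R `` {u @ v}"
    by blast
  then show ?thesis by (simp add: presented_monoid_def)
qed

lemma presented_carrierE:
  assumes "X \<in> carrier (presented_monoid A R)"
  obtains u where "u \<in> lists A" "X = word_cong A R `` {u}"
proof -
  have "X \<in> lists A // word_cong A R" using assms by (simp add: presented_monoid_def)
  then show thesis by (rule quotientE) (rule that)
qed

lemma presented_carrierI:
  "u \<in> lists A \<Longrightarrow> word_cong A R `` {u} \<in> carrier (presented_monoid A R)"
  by (auto simp: presented_monoid_def intro: quotientI)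

lemma monoid_presented_monoid: "monoid (presented_monoid A R)"
proof (rule monoidI)
  have one: "\<one>\<^bsub>presented_monoid A R\<^esub> = word_cong A R `` {[]}"
    by (simp add: presented_monoid_def)
  show "\<one>\<^bsub>presented_monoid A R\<^esub> \<in> carrier (presented_monoid A R)"
    unfolding one by (rule presented_carrierI) simp
  fix X assume X: "X \<in> carrier (presented_monoid A R)"
  then obtain u where u: "u \<in> lists A" "X = word_cong A R `` {u}" by (rule presented_carrierE)
  show "\<one>\<^bsub>presented_monoid A R\<^esub> \<otimes>\<^bsub>presented_monoid A R\<^esub> X = X"
    unfolding one u(2) using u(1) by (subst presented_mult_class) auto
  show "X \<otimes>\<^bsub>presented_monoid A R\<^esub> \<one>\<^bsub>presented_monoid A R\<^esub> = X"
    unfolding one u(2) using u(1) by (subst presented_mult_class) auto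
  fix Y assume Y: "Y \<in> carrier (presented_monoid A R)"
  then obtain v where v: "v \<in> lists A" "Y = word_cong A R `` {v}" by (rule presented_carrierE)
  have uv: "u @ v \<in> lists A" using u v by simp
  show "X \<otimes>\<^bsub>presented_monoid A R\<^esub> Y \<in> carrier (presented_monoid A R)"
    unfolding u(2) v(2) presented_mult_class[OF u(1) v(1)] by (rule presented_carrierI[OF uv])
  fix Z assume Z: "Z \<in> carrier (presented_monoid A R)"
  then obtain z where z: "z \<in> lists A" "Z = word_cong A R `` {z}" by (rule presented_carrierE)
  have vz: "v @ z \<in> lists A" using z v by simp
  show "X \<otimes>\<^bsub>presented_monoid A R\<^esub> Y \<otimes>\<^bsub>presented_monoid A R\<^esub> Z =
      X \<otimes>\<^bsub>presented_monoid A R\<^esub> (Y \<otimes>\<^bsub>presented_monoid A R\<^esub> Z)"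
    unfolding u(2) v(2) z(2) presented_mult_class[OF u(1) v(1)] presented_mult_class[OF v(1) z(1)]
      presented_mult_class[OF uv z(1)] presented_mult_class[OF u(1) vz] by simp
qed

lemma word_prod_Nil [simp]: "word_prod G f [] = \<one>\<^bsub>G\<^esub>"
  by (simp add: word_prod_def)

lemma word_prod_Cons [simp]: "word_prod G f (x # u) = f x \<otimes>\<^bsub>G\<^esub> word_prod G f u"
  by (simp add: word_prod_def)

context monoid
begin

lemma word_prod_closed:
  "f \<in> A \<rightarrow> carrier G \<Longrightarrow> u \<in> lists A \<Longrightarrow> word_prod G f u \<in> carrier G"
  by (induction u) auto

lemma word_prod_append:
  assumes "f \<in> A \<rightarrow> carrier G" "u \<in> lists A" "v \<in> lists A"
  shows "word_prod G f (u @ v) = word_prod G f u \<otimes> word_prod G f v"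
  using assms(2)
proof (induction u)
  case (Cons a u)
  then have "f a \<in> carrier G" "word_prod G f u \<in> carrier G"
    using assms(1) word_prod_closed[OF assms(1)] by auto
  with Cons show ?case using m_assoc word_prod_closed[OF assms(1,3)] by simp
qed (use word_prod_closed[OF assms(1,3)] in auto)

lemma word_prod_cong:
  assumes "f \<in> A \<rightarrow> carrier G"
    and "\<And>l r. (l, r) \<in> R \<Longrightarrow> word_prod G f l = word_prod G f r"
    and "(u, v) \<in> word_cong A R"
  shows "word_prod G f u = word_prod G f v"
  using assms(3)
proof induction
  case (rel l r u v)
  then show ?case using assms(2)[OF rel(1)] by (simp add: word_prod_append[OF assms(1)])
qed auto

lemma presented_eval_class:
  assumes "f \<in> A \<rightarrow> carrier G"
    and "\<And>l r. (l, r) \<in> R \<Longrightarrow> word_prod G f l = word_prod G f r"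
    and "u \<in> lists A"
  shows "presented_eval G f (word_cong A R `` {u}) = word_prod G f u"
proof -
  have "word_prod G f ` (word_cong A R `` {u}) = {word_prod G f u}"
    using word_prod_cong[OF assms(1,2)] word_cong.refl[OF assms(3)] by fastforce
  then show ?thesis by (simp add: presented_eval_def)
qed

lemma presented_eval_hom:
  assumes "f \<in> A \<rightarrow> carrier G"
    and "\<And>l r. (l, r) \<in> R \<Longrightarrow> word_prod G f l = word_prod G f r"
  shows "presented_eval G f \<in> hom (presented_monoid A R) G"
proof (rule homI)
  fix X assume "X \<in> carrier (presented_monoid A R)"
  then obtain u where u: "u \<in> lists A" "X = word_cong A R `` {u}" by (rule presented_carrierE)
  show "presented_eval G f X \<in> carrier G"
    unfolding u(2) by (simp only: presented_eval_class[OF assms u(1)] word_prod_closed[OF assms(1) u(1)])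
  fix Y assume "Y \<in> carrier (presented_monoid A R)"
  then obtain v where v: "v \<in> lists A" "Y = word_cong A R `` {v}" by (rule presented_carrierE)
  have uv: "u @ v \<in> lists A" using u v by simp
  show "presented_eval G f (X \<otimes>\<^bsub>presented_monoid A R\<^esub> Y)
      = presented_eval G f X \<otimes> presented_eval G f Y"
    unfolding u(2) v(2) presented_mult_class[OF u(1) v(1)]
    by (simp only: presented_eval_class[OF assms uv] presented_eval_class[OF assms u(1)]
        presented_eval_class[OF assms v(1)] word_prod_append[OF assms(1) u(1) v(1)])
qed

end

lemma group_presented_monoid:
  assumes inv: "\<And>a. a \<in> A \<Longrightarrow> \<exists>b\<in>A. ([b, a], []) \<in> word_cong A R"
  shows "group (presented_monoid A R)"
proof -
  have one: "\<one>\<^bsub>presented_monoid A R\<^esub> = word_cong A R `` {[]}"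
    by (simp add: presented_monoid_def)
  have left: "\<exists>v\<in>lists A. (v @ u, []) \<in> word_cong A R" if "u \<in> lists A" for u
    using that
  proof (induction u)
    case Nil
    have "([] @ [], []) \<in> word_cong A R" using word_cong.refl[of "[]" A R] by simp
    then show ?case by (rule bexI) simp
  next
    case (Cons a u)
    then obtain v where v: "v \<in> lists A" "(v @ u, []) \<in> word_cong A R" by blast
    obtain b where b: "b \<in> A" "([b, a], []) \<in> word_cong A R" using inv[OF Cons(1)] by blast
    have "((v @ [b, a]) @ u, (v @ []) @ u) \<in> word_cong A R"
      by (rule word_cong_append_right[OF word_cong_append_left[OF b(2) v(1)] Cons(2)])
    then have "(v @ [b, a] @ u, []) \<in> word_cong A R" using word_cong.trans[OF _ v(2)] by simp
    then have "((v @ [b]) @ a # u, []) \<in> word_cong A R" by simp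
    moreover have "v @ [b] \<in> lists A" using v(1) b(1) by simp
    ultimately show ?case by (rule bexI)
  qed
  show ?thesis
  proof (rule monoid.group_l_invI[OF monoid_presented_monoid])
    fix X assume "X \<in> carrier (presented_monoid A R)"
    then obtain u where u: "u \<in> lists A" "X = word_cong A R `` {u}" by (rule presented_carrierE)
    obtain v where v: "v \<in> lists A" "(v @ u, []) \<in> word_cong A R" using left[OF u(1)] by blast
    have "word_cong A R `` {v} \<otimes>\<^bsub>presented_monoid A R\<^esub> X = \<one>\<^bsub>presented_monoid A R\<^esub>"
      unfolding one u(2) presented_mult_class[OF v(1) u(1)]
      using equiv_class_eq[OF equiv_word_cong v(2)] .
    then show "\<exists>Y\<in>carrier (presented_monoid A R).
        Y \<otimes>\<^bsub>presented_monoid A R\<^esub> X = \<one>\<^bsub>presented_monoid A R\<^esub>"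
      using presented_carrierI[OF v(1)] by (rule bexI)
  qed
qed


section \<open>Free groups and free products\<close>

text \<open>The generators of \<open>F\<^sub>k\<close> are \<open>x\<^sub>0, \<dots>, x\<^sub>k\<^sub>-\<^sub>1\<close>; the letter \<open>(i, True)\<close> stands for \<open>x\<^sub>i\<close> and
  \<open>(i, False)\<close> for its inverse.\<close>

definition free_letters :: "nat \<Rightarrow> (nat \<times> bool) set" where
  "free_letters k = {..<k} \<times> UNIV"

definition free_rels :: "nat \<Rightarrow> ((nat \<times> bool) list \<times> (nat \<times> bool) list) set" where
  "free_rels k = {([(i, b), (i, \<not> b)], []) | i b. i < k}"

definition free_group :: "nat \<Rightarrow> (nat \<times> bool) list set monoid" where
  "free_group k = presented_monoid (free_letters k) (free_rels k)"

definition free_product_letters ::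
    "('a, 'm) monoid_scheme \<Rightarrow> ('b, 'n) monoid_scheme \<Rightarrow> ('a + 'b) set" where
  "free_product_letters G H = carrier G <+> carrier H"

definition free_product_rels ::
    "('a, 'm) monoid_scheme \<Rightarrow> ('b, 'n) monoid_scheme \<Rightarrow> (('a + 'b) list \<times> ('a + 'b) list) set" where
  "free_product_rels G H =
     {([Inl a, Inl b], [Inl (a \<otimes>\<^bsub>G\<^esub> b)]) | a b. a \<in> carrier G \<and> b \<in> carrier G} \<union>
     {([Inr a, Inr b], [Inr (a \<otimes>\<^bsub>H\<^esub> b)]) | a b. a \<in> carrier H \<and> b \<in> carrier H} \<union>
     {([Inl \<one>\<^bsub>G\<^esub>], []), ([Inr \<one>\<^bsub>H\<^esub>], [])}"

definition free_product ::
    "('a, 'm) monoid_scheme \<Rightarrow> ('b, 'n) monoid_scheme \<Rightarrow> ('a + 'b) list set monoid" where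
  "free_product G H = presented_monoid (free_product_letters G H) (free_product_rels G H)"

lemma group_free_group: "group (free_group k)"
  unfolding free_group_def
proof (rule group_presented_monoid)
  fix a assume "a \<in> free_letters k"
  then obtain i b where a: "a = (i, b)" "i < k" by (auto simp: free_letters_def)
  have "([] @ [(i, \<not> b), (i, \<not> \<not> b)] @ [], [] @ [] @ []) \<in> word_cong (free_letters k) (free_rels k)"
    using a by (intro word_cong.rel) (auto simp: free_rels_def free_letters_def)
  then show "\<exists>c\<in>free_letters k. ([c, a], []) \<in> word_cong (free_letters k) (free_rels k)"
    using a by (intro bexI[of _ "(i, \<not> b)"]) (auto simp: free_letters_def)
qed

lemma group_free_product:
  assumes "group G" "group H"
  shows "group (free_product G H)"
  unfolding free_product_def
proof (rule group_presented_monoid)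
  interpret G: group G by fact
  interpret H: group H by fact
  let ?A = "free_product_letters G H" and ?R = "free_product_rels G H"
  have step: "(l, r) \<in> word_cong ?A ?R" if "(l, r) \<in> ?R" "l \<in> lists ?A" "r \<in> lists ?A" for l r
    using word_cong.rel[OF that, of "[]" "[]"] by simp
  fix a assume "a \<in> ?A"
  then consider g where "a = Inl g" "g \<in> carrier G" | h where "a = Inr h" "h \<in> carrier H"
    by (auto simp: free_product_letters_def)
  then show "\<exists>b\<in>?A. ([b, a], []) \<in> word_cong ?A ?R"
  proof cases
    case (1 g)
    have "([Inl (inv\<^bsub>G\<^esub> g), Inl g], [Inl (inv\<^bsub>G\<^esub> g \<otimes>\<^bsub>G\<^esub> g)]) \<in> word_cong ?A ?R"
      using 1 by (intro step) (auto simp: free_product_rels_def free_product_letters_def)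
    moreover have "([Inl \<one>\<^bsub>G\<^esub>], []) \<in> word_cong ?A ?R"
      by (intro step) (auto simp: free_product_rels_def free_product_letters_def)
    ultimately have "([Inl (inv\<^bsub>G\<^esub> g), a], []) \<in> word_cong ?A ?R"
      using 1 word_cong.trans by fastforce
    then show ?thesis using 1 by (intro bexI) (auto simp: free_product_letters_def)
  next
    case (2 h)
    have "([Inr (inv\<^bsub>H\<^esub> h), Inr h], [Inr (inv\<^bsub>H\<^esub> h \<otimes>\<^bsub>H\<^esub> h)]) \<in> word_cong ?A ?R"
      using 2 by (intro step) (auto simp: free_product_rels_def free_product_letters_def)
    moreover have "([Inr \<one>\<^bsub>H\<^esub>], []) \<in> word_cong ?A ?R"
      by (intro step) (auto simp: free_product_rels_def free_product_letters_def)
    ultimately have "([Inr (inv\<^bsub>H\<^esub> h), a], []) \<in> word_cong ?A ?R"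
      using 2 word_cong.trans by fastforce
    then show ?thesis using 2 by (intro bexI) (auto simp: free_product_letters_def)
  qed
qed


section \<open>Substitution\<close>

abbreviation tuples :: "nat \<Rightarrow> ('a, 'm) monoid_scheme \<Rightarrow> (nat \<Rightarrow> 'a) set" where
  "tuples k G \<equiv> {..<k} \<rightarrow>\<^sub>E carrier G"

definition letter_val :: "('a, 'm) monoid_scheme \<Rightarrow> (nat \<Rightarrow> 'a) \<Rightarrow> nat \<times> bool \<Rightarrow> 'a" where
  "letter_val G g = (\<lambda>(i, b). if b then g i else inv\<^bsub>G\<^esub> (g i))"

definition subst_word :: "('a, 'm) monoid_scheme \<Rightarrow> (nat \<times> bool) list set \<Rightarrow> (nat \<Rightarrow> 'a) \<Rightarrow> 'a" where
  "subst_word G w g = presented_eval G (letter_val G g) w"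

definition word_values :: "('a, 'm) monoid_scheme \<Rightarrow> nat \<Rightarrow> (nat \<times> bool) list set \<Rightarrow> 'a set" where
  "word_values G k w = subst_word G w ` tuples k G"

definition subst_const ::
    "('a, 'm) monoid_scheme \<Rightarrow> ('a + (nat \<times> bool) list set) list set \<Rightarrow> (nat \<Rightarrow> 'a) \<Rightarrow> 'a" where
  "subst_const H v h = presented_eval H (case_sum (\<lambda>c. c) (\<lambda>w. subst_word H w h)) v"

context group
begin

lemma letter_val_closed:
  assumes "g \<in> tuples k G"
  shows "letter_val G g \<in> free_letters k \<rightarrow> carrier G"
proof (rule Pi_I)
  fix x assume "x \<in> free_letters k"
  then have "g (fst x) \<in> carrier G"
    using PiE_mem[OF assms, of "fst x"] by (auto simp: free_letters_def)
  then show "letter_val G g x \<in> carrier G"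
    by (simp add: letter_val_def split_beta)
qed

lemma letter_val_rels:
  assumes "g \<in> tuples k G" "(l, r) \<in> free_rels k"
  shows "word_prod G (letter_val G g) l = word_prod G (letter_val G g) r"
proof -
  obtain i b where lr: "l = [(i, b), (i, \<not> b)]" "r = []" and i: "i < k"
    using assms(2) unfolding free_rels_def by blast
  have "g i \<in> carrier G" using PiE_mem[OF assms(1), of i] i by simp
  then show ?thesis by (cases b) (simp_all add: lr letter_val_def)
qed

lemma subst_word_class:
  assumes "g \<in> tuples k G" "u \<in> lists (free_letters k)"
  shows "subst_word G (word_cong (free_letters k) (free_rels k) `` {u}) g
    = word_prod G (letter_val G g) u"
  unfolding subst_word_def
  by (rule presented_eval_class[OF letter_val_closed[OF assms(1)] letter_val_rels[OF assms(1)] assms(2)])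

lemma subst_word_hom:
  assumes "g \<in> tuples k G"
  shows "(\<lambda>w. subst_word G w g) \<in> hom (free_group k) G"
  unfolding subst_word_def free_group_def
  by (rule presented_eval_hom[OF letter_val_closed[OF assms] letter_val_rels[OF assms]])

lemma subst_const_letters:
  assumes "h \<in> tuples k G"
  shows "case_sum (\<lambda>c. c) (\<lambda>w. subst_word G w h)
    \<in> free_product_letters G (free_group k) \<rightarrow> carrier G"
proof (rule Pi_I)
  fix x assume "x \<in> free_product_letters G (free_group k)"
  then consider c where "x = Inl c" "c \<in> carrier G" | w where "x = Inr w" "w \<in> carrier (free_group k)"
    unfolding free_product_letters_def by (elim PlusE) blast+
  then show "case_sum (\<lambda>c. c) (\<lambda>w. subst_word G w h) x \<in> carrier G"
    using hom_in_carrier[OF subst_word_hom[OF assms]] by cases simp_all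
qed

lemma subst_const_rels:
  assumes "h \<in> tuples k G" "(l, r) \<in> free_product_rels G (free_group k)"
  shows "word_prod G (case_sum (\<lambda>c. c) (\<lambda>w. subst_word G w h)) l
    = word_prod G (case_sum (\<lambda>c. c) (\<lambda>w. subst_word G w h)) r"
proof -
  have hom: "(\<lambda>w. subst_word G w h) \<in> hom (free_group k) G"
    by (rule subst_word_hom[OF assms(1)])
  have one: "subst_word G \<one>\<^bsub>free_group k\<^esub> h = \<one>"
    by (rule hom_one[OF hom group_free_group is_group])
  have mult: "subst_word G (a \<otimes>\<^bsub>free_group k\<^esub> b) h = subst_word G a h \<otimes> subst_word G b h"
      "subst_word G a h \<in> carrier G" "subst_word G b h \<in> carrier G"
    if "a \<in> carrier (free_group k)" "b \<in> carrier (free_group k)" for a b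
    using hom that by (auto simp: hom_def)
  show ?thesis using assms(2) by (auto simp: free_product_rels_def one mult)
qed

lemma subst_const_class:
  assumes "h \<in> tuples k G" "u \<in> lists (free_product_letters G (free_group k))"
  shows "subst_const G (word_cong (free_product_letters G (free_group k))
      (free_product_rels G (free_group k)) `` {u}) h
    = word_prod G (case_sum (\<lambda>c. c) (\<lambda>w. subst_word G w h)) u"
  unfolding subst_const_def
  by (rule presented_eval_class[OF subst_const_letters[OF assms(1)] subst_const_rels[OF assms(1)] assms(2)])

lemma subst_const_hom:
  assumes "h \<in> tuples k G"
  shows "(\<lambda>v. subst_const G v h) \<in> hom (free_product G (free_group k)) G"
  unfolding subst_const_def free_product_def
  by (rule presented_eval_hom[OF subst_const_letters[OF assms] subst_const_rels[OF assms]])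

end


section \<open>Equationally Noetherian groups\<close>

definition solution_set ::
    "('a, 'm) monoid_scheme \<Rightarrow> nat \<Rightarrow> ('a + (nat \<times> bool) list set) list set set \<Rightarrow> (nat \<Rightarrow> 'a) set" where
  "solution_set H k S = {h \<in> tuples k H. \<forall>v\<in>S. subst_const H v h = \<one>\<^bsub>H\<^esub>}"

text \<open>The complements of the solution sets form a sub-basis of open sets; \<open>relative_to\<close> puts
  the whole of \<open>H\<^sup>k\<close> among the basic open sets, as the empty intersection.\<close>

definition verbal_topology :: "('a, 'm) monoid_scheme \<Rightarrow> nat \<Rightarrow> (nat \<Rightarrow> 'a) topology" where
  "verbal_topology H k = topology (arbitrary union_of
     (finite intersection_of
       (\<lambda>U. \<exists>S \<subseteq> carrier (free_product H (free_group k)). U = tuples k H - solution_set H k S)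
      relative_to tuples k H))"

definition equationally_noetherian :: "('a, 'm) monoid_scheme \<Rightarrow> bool" where
  "equationally_noetherian H \<longleftrightarrow> group H \<and>
     (\<forall>k. \<forall>C :: nat \<Rightarrow> (nat \<Rightarrow> 'a) set.
        (\<forall>n. closedin (verbal_topology H k) (C n)) \<and> (\<forall>n. C (Suc n) \<subseteq> C n)
        \<longrightarrow> (\<exists>N. \<forall>n\<ge>N. C n = C N))"

lemma topspace_verbal_topology [simp]: "topspace (verbal_topology H k) = tuples k H"
  unfolding verbal_topology_def by (rule topspace_subbase)

lemma closedin_solution_set:
  assumes "S \<subseteq> carrier (free_product H (free_group k))"
  shows "closedin (verbal_topology H k) (solution_set H k S)"
proof -
  let ?P = "\<lambda>U. \<exists>S \<subseteq> carrier (free_product H (free_group k)). U = tuples k H - solution_set H k S"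
  let ?U = "tuples k H - solution_set H k S"
  have "(finite intersection_of ?P) ?U"
    by (rule finite_intersection_of_inc) (use assms in blast)
  then have "(finite intersection_of ?P relative_to tuples k H) (tuples k H \<inter> ?U)"
    by (rule relative_to_inc)
  moreover have "tuples k H \<inter> ?U = ?U" by (rule Int_absorb1) (rule Diff_subset)
  ultimately have "(finite intersection_of ?P relative_to tuples k H) ?U" by (simp only:)
  then have "openin (verbal_topology H k) ?U"
    unfolding verbal_topology_def openin_subbase
    by (rule arbitrary_union_of_inc)
  moreover have "solution_set H k S \<subseteq> tuples k H"
    by (simp add: solution_set_def)
  ultimately show ?thesis by (simp add: closedin_def)
qed


section \<open>Profinite groups\<close>

locale topological_group = group G for G :: "('a, 'm) monoid_scheme" (structure) +
  fixes T :: "'a topology"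
  assumes topspace_eq: "topspace T = carrier G"
    and continuous_mult: "continuous_map (prod_topology T T) T (\<lambda>(x, y). x \<otimes> y)"
    and continuous_inv: "continuous_map T T (\<lambda>x. inv x)"

locale profinite_group = topological_group +
  assumes compact: "compact_space T"
    and Hausdorff: "Hausdorff_space T"
    and totally_disconnected: "\<And>x. x \<in> carrier G \<Longrightarrow> connected_component_of_set T x = {x}"

end

theory Submission
  imports Defs
begin

text \<open>A continuous map with fewer than \<open>2^\<aleph>\<^sub>0\<close> values on a compact Hausdorff space is constant on some
  nonempty open part of every open set, since perfect sets have at least continuum many points.
  As \<open>H\<close> is dense, near any point of \<open>G\<^sup>k\<close> there are thus \<open>a \<in> H\<^sup>k\<close> and a neighbourhood \<open>U\<close> of the
  identity with \<open>w(a x) = w(a)\<close> for \<open>x \<in> U\<^sup>k\<close>. Noetherianity gives a neighbourhood \<open>U\<^sub>0\<close> for which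
  \<open>(U\<^sub>0 \<inter> H)\<^sup>k\<close> has the smallest verbal closure, so the identity spreads from \<open>(U \<inter> H)\<^sup>k\<close> to
  \<open>(U\<^sub>0 \<inter> H)\<^sup>k\<close>, and by density and continuity to \<open>U\<^sub>0\<^sup>k\<close>. Because \<open>U\<^sub>0\<close> does not depend on the
  point, \<open>w\<close> is locally constant, hence takes finitely many values by compactness.\<close>

section \<open>Maps with few values on compact Hausdorff spaces\<close>

text \<open>Regularity puts the closure \<open>D\<close> of a nonempty open \<open>Q\<close> inside
  \<open>W\<close>. The image of \<open>D\<close> is compact Hausdorff and too small to be perfect,
  so it has an isolated point \<open>p\<close>. Taking the closure of an open set matters: the open
  preimage of a neighbourhood isolating \<open>p\<close> meets \<open>D\<close>, hence already meets
  \<open>Q\<close>, and that intersection is the required open set.\<close>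

lemma constant_on_open_subset:
  assumes "compact_space X" "Hausdorff_space X" "Hausdorff_space Y"
    and f: "continuous_map X Y f"
    and small: "f ` topspace X \<prec> Pow (UNIV :: nat set)"
    and W: "openin X W" "W \<noteq> {}"
  obtains V p where "openin X V" "V \<noteq> {}" "V \<subseteq> W" "\<And>x. x \<in> V \<Longrightarrow> f x = p"
proof -
  obtain x where x: "x \<in> W" using W(2) by blast
  have "neighbourhood_base_of (closedin X) X"
    using assms(1,2) by (simp add: neighbourhood_base_of_closedin compact_Hausdorff_imp_regular_space)
  then obtain Q C where Q: "openin X Q" "closedin X C" "x \<in> Q" "Q \<subseteq> C" "C \<subseteq> W"
    using W(1) x unfolding neighbourhood_base_of by meson
  have sub: "X closure_of Q \<subseteq> C" using Q(2,4) by (rule closure_of_minimal[rotated])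
  define D where "D = X closure_of Q"
  have "Q \<subseteq> D" unfolding D_def by (simp add: closure_of_subset Q(1) openin_subset)
  have D: "closedin X D" "D \<subseteq> topspace X" by (simp_all add: D_def closure_of_subset_topspace)
  have compD: "compactin X D" by (simp add: D(1) assms(1) closedin_compact_space)
  define Z where "Z = subtopology Y (f ` D)"
  have fD: "f ` D \<subseteq> topspace Y" using f D(2) continuous_map_image_subset_topspace by blast
  have topZ: "topspace Z = f ` D" using fD by (auto simp: Z_def)
  have "compact_space Z"
    unfolding Z_def using image_compactin[OF compD f] by (simp add: compact_space_subtopology)
  then have lc: "locally_compact_space Z" by (rule compact_imp_locally_compact_space)
  have "Hausdorff_space Z" unfolding Z_def by (simp add: Hausdorff_space_subtopology assms(3))
  moreover have ne: "topspace Z \<noteq> {}" using topZ Q(3) \<open>Q \<subseteq> D\<close> by blast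
  moreover have "\<not> (UNIV :: real set) \<lesssim> topspace Z"
  proof
    assume "(UNIV :: real set) \<lesssim> topspace Z"
    then have "(UNIV :: nat set set) \<lesssim> topspace Z"
      using nat_sets_eqpoll_reals lepoll_trans2 lepoll_trans1 eqpoll_imp_lepoll lepoll_trans by blast
    also have "topspace Z \<lesssim> f ` topspace X" using topZ D(2) by (simp add: image_mono subset_imp_lepoll)
    also have "\<dots> \<prec> Pow (UNIV :: nat set)" by (rule small)
    finally show False by simp
  qed
  \<comment> \<open>A nonempty perfect locally compact Hausdorff space would contain a copy of the
    reals.\<close>
  ultimately have "Z derived_set_of topspace Z \<noteq> topspace Z"
    using lepoll_perfect_set_aux[OF lc] by blast
  then obtain p where p: "p \<in> topspace Z" "openin Z {p}"
    by (auto simp: derived_set_of_topspace)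
  then obtain B where B: "openin Y B" "{p} = B \<inter> f ` D" by (auto simp: Z_def openin_subtopology)
  define E where "E = {x \<in> topspace X. f x \<in> B}"
  have E: "openin X E" unfolding E_def by (rule openin_continuous_map_preimage[OF f B(1)])
  have "E \<inter> D \<noteq> {}"
  proof -
    have "p \<in> B \<inter> f ` D" using B(2) by blast
    then show ?thesis using D(2) by (auto simp: E_def)
  qed
  then have "E \<inter> Q \<noteq> {}" unfolding D_def by (metis E openin_Int_closure_of_eq_empty)
  show thesis
  proof (rule that)
    show "openin X (E \<inter> Q)" using E Q(1) by blast
    show "E \<inter> Q \<subseteq> W" using Q by blast
    show "f x = p" if "x \<in> E \<inter> Q" for x
      using that B(2) \<open>Q \<subseteq> D\<close> by (auto simp: E_def)
  qed fact
qed

lemma finite_image_if_locally_constant: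
  assumes "compact_space X"
    and loc: "\<And>x. x \<in> topspace X \<Longrightarrow> \<exists>V. openin X V \<and> x \<in> V \<and> (\<forall>y\<in>V. f y = f x)"
  shows "finite (f ` topspace X)"
proof -
  obtain V where V: "\<And>x. x \<in> topspace X \<Longrightarrow> openin X (V x) \<and> x \<in> V x \<and> (\<forall>y\<in>V x. f y = f x)"
    using loc by metis
  have "\<forall>U\<in>V ` topspace X. openin X U" "topspace X \<subseteq> \<Union> (V ` topspace X)" using V by blast+
  then obtain \<F> where \<F>: "finite \<F>" "\<F> \<subseteq> V ` topspace X" "topspace X \<subseteq> \<Union>\<F>"
    using assms(1) unfolding compact_space_alt by meson
  then obtain A where A: "finite A" "A \<subseteq> topspace X" "\<F> = V ` A" by (meson finite_subset_image)
  have "f ` topspace X \<subseteq> f ` A"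
  proof (rule image_subsetI)
    fix x assume "x \<in> topspace X"
    then obtain a where "a \<in> A" "x \<in> V a" using \<F>(3) A(3) by blast
    then have "f x = f a" using A(2) V by blast
    then show "f x \<in> f ` A" using \<open>a \<in> A\<close> by simp
  qed
  then show ?thesis using A(1) finite_surj by blast
qed

section \<open>A minimum principle for systems of equations\<close>

text \<open>The chain condition concerns closed sets, but the application needs it for an arbitrary
  family of point sets. It is transferred by sending each set to the smallest solution set
  containing it; \<open>Y\<^sub>0\<close> is a member for which passing to a smaller member yields
  no new equation.\<close>

lemma equationally_noetherian_minimal:
  assumes H: "equationally_noetherian H"
    and \<Y>: "\<Y> \<noteq> {}" "\<And>Y. Y \<in> \<Y> \<Longrightarrow> Y \<subseteq> tuples k H"
  obtains Y\<^sub>0 where "Y\<^sub>0 \<in> \<Y>"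
    and "\<forall>Y\<in>\<Y>. Y \<subseteq> Y\<^sub>0 \<longrightarrow> (\<forall>v\<in>carrier (free_product H (free_group k)).
      (\<forall>y\<in>Y. subst_const H v y = \<one>\<^bsub>H\<^esub>) \<longrightarrow> (\<forall>x\<in>Y\<^sub>0. subst_const H v x = \<one>\<^bsub>H\<^esub>))"
proof (rule ccontr)
  assume "\<not> thesis"
  note minimal = that
  define I where "I Y = {v \<in> carrier (free_product H (free_group k)). \<forall>y\<in>Y. subst_const H v y = \<one>\<^bsub>H\<^esub>}"
    for Y
  have "\<exists>Y'. Y' \<in> \<Y> \<and> Y' \<subseteq> Y \<and> \<not> I Y' \<subseteq> I Y" if "Y \<in> \<Y>" for Y
  proof (rule ccontr)
    assume "\<nexists>Y'. Y' \<in> \<Y> \<and> Y' \<subseteq> Y \<and> \<not> I Y' \<subseteq> I Y"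
    then have *: "I Y' \<subseteq> I Y" if "Y' \<in> \<Y>" "Y' \<subseteq> Y" for Y' using that by blast
    have thesis
    proof (rule minimal[OF \<open>Y \<in> \<Y>\<close>], intro ballI impI)
      fix Y' v x
      assume Y': "Y' \<in> \<Y>" "Y' \<subseteq> Y" and "v \<in> carrier (free_product H (free_group k))"
        and "\<forall>y\<in>Y'. subst_const H v y = \<one>\<^bsub>H\<^esub>" and x: "x \<in> Y"
      then have "v \<in> I Y'" by (simp add: I_def)
      then have "v \<in> I Y" using *[OF Y'] by blast
      then show "subst_const H v x = \<one>\<^bsub>H\<^esub>" using x by (simp add: I_def)
    qed
    with \<open>\<not> thesis\<close> show False ..
  qed
  \<comment> \<open>If no member were minimal, dependent choice would give a descending sequence in
    which every term satisfies an equation that fails somewhere on its predecessor.\<close>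
  then have "\<exists>F :: nat \<Rightarrow> _. \<forall>n. F n \<in> \<Y> \<and> (F (Suc n) \<subseteq> F n \<and> \<not> I (F (Suc n)) \<subseteq> I (F n))"
    using \<Y>(1) by (intro dependent_nat_choice) auto
  then obtain F :: "nat \<Rightarrow> _" where F: "\<And>n. F n \<in> \<Y>" "\<And>n. F (Suc n) \<subseteq> F n"
      "\<And>n. \<not> I (F (Suc n)) \<subseteq> I (F n)"
    by blast
  let ?C = "\<lambda>n. solution_set H k (I (F n))"
  have "\<forall>n. closedin (verbal_topology H k) (?C n)"
    by (auto intro!: closedin_solution_set simp: I_def)
  moreover have "\<forall>n. ?C (Suc n) \<subseteq> ?C n"
  proof
    fix n
    have "I (F n) \<subseteq> I (F (Suc n))" using F(2)[of n] by (auto simp: I_def)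
    then show "?C (Suc n) \<subseteq> ?C n" by (auto simp: solution_set_def)
  qed
  moreover have "\<forall>C. (\<forall>n. closedin (verbal_topology H k) (C n)) \<and> (\<forall>n. C (Suc n) \<subseteq> C n)
      \<longrightarrow> (\<exists>N. \<forall>n\<ge>N. C n = C N)"
    using H unfolding equationally_noetherian_def by (elim conjE) (rule spec)
  ultimately have "\<exists>N. \<forall>n\<ge>N. ?C n = ?C N" by (elim allE[of _ ?C]) blast
  then obtain N where N: "\<forall>n\<ge>N. ?C n = ?C N" ..
  have eq: "?C (Suc N) = ?C N" by (rule N[rule_format]) simp
  \<comment> \<open>Once the chain is stationary at \<open>N\<close>, the points of
    \<open>F N\<close> solve all equations of \<open>F (Suc N)\<close>, so no equation was gained in
    this step.\<close>
  have "F N \<subseteq> ?C N" using \<Y>(2)[OF F(1)[of N]] by (auto simp: solution_set_def I_def)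
  then have sub: "F N \<subseteq> ?C (Suc N)" by (simp only: eq)
  have "I (F (Suc N)) \<subseteq> I (F N)"
  proof
    fix v assume v: "v \<in> I (F (Suc N))"
    then have "subst_const H v y = \<one>\<^bsub>H\<^esub>" if "y \<in> F N" for y
      using sub that by (auto simp: solution_set_def)
    then show "v \<in> I (F N)" using v by (simp add: I_def)
  qed
  with F(3) show False by blast
qed

section \<open>Translated words as equations with constants\<close>

context group
begin

lemma mult_tuples:
  assumes "a \<in> tuples k G" "x \<in> tuples k G"
  shows "(\<lambda>i\<in>{..<k}. a i \<otimes> x i) \<in> tuples k G"
  using assms by (auto simp: PiE_iff)

text \<open>Spelling out \<open>u\<close> after the substitution of \<open>a i\<close> times the
  i-th variable for that variable, and appending the inverse of the value at \<open>a\<close> as a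
  constant, gives an element of the free product. Applied inside a subgroup, it makes equality of
  the values at \<open>a x\<close> and \<open>a\<close> a verbal condition on
  \<open>x\<close>.\<close>

lemma translation_equation:
  assumes a: "a \<in> tuples k G" and u: "u \<in> lists (free_letters k)"
  obtains v where "v \<in> carrier (free_product G (free_group k))"
    and "\<And>x. x \<in> tuples k G \<Longrightarrow> subst_const G v x =
      word_prod G (letter_val G (\<lambda>i\<in>{..<k}. a i \<otimes> x i)) u \<otimes> inv (word_prod G (letter_val G a) u)"
proof -
  let ?L = "free_product_letters G (free_group k)"
  let ?cls = "\<lambda>l. word_cong (free_letters k) (free_rels k) `` {[l]}"
  \<comment> \<open>The spelling of one letter after the substitution; for an inverse letter the
    order of the two factors is reversed.\<close>
  define s where "s = (\<lambda>l. if snd l then [Inl (a (fst l)), Inr (?cls l)]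
    else [Inr (?cls l), Inl (inv (a (fst l)))])"
  have cls: "?cls l \<in> carrier (free_group k)" if "l \<in> free_letters k" for l
    unfolding free_group_def by (rule presented_carrierI) (use that in simp)
  have ai: "a (fst l) \<in> carrier G" if "l \<in> free_letters k" for l
    using PiE_mem[OF a, of "fst l"] that by (auto simp: free_letters_def)
  have s: "s l \<in> lists ?L" if "l \<in> free_letters k" for l
    using cls[OF that] ai[OF that] by (auto simp: s_def free_product_letters_def)
  have sval: "word_prod G (case_sum (\<lambda>c. c) (\<lambda>w. subst_word G w x)) (s l)
      = letter_val G (\<lambda>i\<in>{..<k}. a i \<otimes> x i) l"
    if l: "l \<in> free_letters k" and x: "x \<in> tuples k G" for l x
  proof -
    have i: "fst l < k" using l by (auto simp: free_letters_def)
    then have xi: "x (fst l) \<in> carrier G" using PiE_mem[OF x, of "fst l"] by simp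
    have "subst_word G (?cls l) x = word_prod G (letter_val G x) [l]"
      by (rule subst_word_class[OF x]) (use l in simp)
    then show ?thesis using ai[OF l] xi i
      by (cases l) (auto simp: s_def letter_val_def inv_mult_group)
  qed
  have cl: "concat (map s z) \<in> lists ?L" if "z \<in> lists (free_letters k)" for z
    using that s by (induction z) auto
  have val: "word_prod G (case_sum (\<lambda>c. c) (\<lambda>w. subst_word G w x)) (concat (map s z))
      = word_prod G (letter_val G (\<lambda>i\<in>{..<k}. a i \<otimes> x i)) z"
    if "z \<in> lists (free_letters k)" and x: "x \<in> tuples k G" for z x
    using that(1)
  proof (induction z)
    case (Cons l z)
    show ?case
      unfolding list.map concat.simps word_prod_append[OF subst_const_letters[OF x] s[OF Cons(1)] cl[OF Cons(2)]]
        sval[OF Cons(1) x] Cons.IH word_prod_Cons ..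
  qed simp
  define c where "c = inv (word_prod G (letter_val G a) u)"
  have c: "c \<in> carrier G"
    unfolding c_def by (intro inv_closed word_prod_closed[OF letter_val_closed[OF a] u])
  have mem: "[Inl c] \<in> lists ?L" using c by (auto simp: free_product_letters_def)
  let ?t = "concat (map s u) @ [Inl c]"
  have t: "?t \<in> lists ?L" using mem cl[OF u] by simp
  show thesis
  proof (rule that)
    show "word_cong ?L (free_product_rels G (free_group k)) `` {?t} \<in> carrier (free_product G (free_group k))"
      unfolding free_product_def by (rule presented_carrierI[OF t])
    fix x assume x: "x \<in> tuples k G"
    show "subst_const G (word_cong ?L (free_product_rels G (free_group k)) `` {?t}) x =
      word_prod G (letter_val G (\<lambda>i\<in>{..<k}. a i \<otimes> x i)) u \<otimes> inv (word_prod G (letter_val G a) u)"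
      unfolding subst_const_class[OF x t] word_prod_append[OF subst_const_letters[OF x] cl[OF u] mem]
        val[OF u x]
      using c by (simp add: c_def)
  qed
qed

lemma word_prod_subgroup:
  assumes "subgroup H G" "x \<in> tuples k (G\<lparr>carrier := H\<rparr>)" "u \<in> lists (free_letters k)"
  shows "word_prod (G\<lparr>carrier := H\<rparr>) (letter_val (G\<lparr>carrier := H\<rparr>) x) u = word_prod G (letter_val G x) u"
  using assms(3)
proof (induction u)
  case (Cons l u)
  have "x (fst l) \<in> H" using Cons(1) PiE_mem[OF assms(2), of "fst l"] by (auto simp: free_letters_def)
  with Cons m_inv_consistent[OF assms(1)] show ?case by (auto simp: letter_val_def split_beta)
qed simp

text \<open>The coset identity \<open>w(a x) = w(a)\<close> is an equation over \<open>H\<close>, so it carries over from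
  one box in \<open>H\<^sup>k\<close> to any box having no smaller verbal closure.\<close>

lemma noetherian_box:
  assumes H: "subgroup H G" "equationally_noetherian (G\<lparr>carrier := H\<rparr>)"
    and \<U>: "\<U> \<noteq> {}" and u: "u \<in> lists (free_letters k)"
  obtains U\<^sub>0 where "U\<^sub>0 \<in> \<U>"
    and "\<And>U a x. \<lbrakk>U \<in> \<U>; U \<subseteq> U\<^sub>0; a \<in> {..<k} \<rightarrow>\<^sub>E H;
      \<forall>y \<in> {..<k} \<rightarrow>\<^sub>E H \<inter> U.
        word_prod G (letter_val G (\<lambda>i\<in>{..<k}. a i \<otimes> y i)) u = word_prod G (letter_val G a) u;
      x \<in> {..<k} \<rightarrow>\<^sub>E H \<inter> U\<^sub>0\<rbrakk>
      \<Longrightarrow> word_prod G (letter_val G (\<lambda>i\<in>{..<k}. a i \<otimes> x i)) u = word_prod G (letter_val G a) u"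
proof -
  let ?H = "G\<lparr>carrier := H\<rparr>"
  let ?w = "\<lambda>x. word_prod G (letter_val G x) u"
  \<comment> \<open>The equation is built in the subgroup itself, so that its constants lie in
    \<open>H\<close> and the chain condition applies.\<close>
  interpret H: group ?H by (rule subgroup.subgroup_is_group[OF H(1) is_group])
  have sub: "({..<k} \<rightarrow>\<^sub>E H \<inter> U) \<subseteq> tuples k ?H" for U by (intro PiE_mono) auto
  have ne: "(\<lambda>U. {..<k} \<rightarrow>\<^sub>E H \<inter> U) ` \<U> \<noteq> {}" using \<U> by simp
  have subs: "Y \<subseteq> tuples k ?H" if "Y \<in> (\<lambda>U. {..<k} \<rightarrow>\<^sub>E H \<inter> U) ` \<U>" for Y
    using that sub by blast
  obtain Y where Y: "Y \<in> (\<lambda>U. {..<k} \<rightarrow>\<^sub>E H \<inter> U) ` \<U>"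
    and min: "\<forall>Y'\<in>(\<lambda>U. {..<k} \<rightarrow>\<^sub>E H \<inter> U) ` \<U>. Y' \<subseteq> Y \<longrightarrow>
      (\<forall>v\<in>carrier (free_product ?H (free_group k)).
        (\<forall>y\<in>Y'. subst_const ?H v y = \<one>\<^bsub>?H\<^esub>) \<longrightarrow> (\<forall>x\<in>Y. subst_const ?H v x = \<one>\<^bsub>?H\<^esub>))"
    by (rule equationally_noetherian_minimal[OF H(2) ne subs]) blast
  then obtain U0 where U0: "U0 \<in> \<U>" "Y = ({..<k} \<rightarrow>\<^sub>E H \<inter> U0)" by blast
  show thesis
  proof (rule that[OF U0(1)])
    fix U a x
    assume U: "U \<in> \<U>" "U \<subseteq> U0" and a: "a \<in> {..<k} \<rightarrow>\<^sub>E H"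
      and const: "\<forall>y \<in> {..<k} \<rightarrow>\<^sub>E H \<inter> U. ?w (\<lambda>i\<in>{..<k}. a i \<otimes> y i) = ?w a"
      and x: "x \<in> {..<k} \<rightarrow>\<^sub>E H \<inter> U0"
    have aH: "a \<in> tuples k ?H" using a by simp
    obtain v where v: "v \<in> carrier (free_product ?H (free_group k))"
      and vx: "\<And>x. x \<in> tuples k ?H \<Longrightarrow> subst_const ?H v x =
        word_prod ?H (letter_val ?H (\<lambda>i\<in>{..<k}. a i \<otimes>\<^bsub>?H\<^esub> x i)) u
          \<otimes>\<^bsub>?H\<^esub> inv\<^bsub>?H\<^esub> (word_prod ?H (letter_val ?H a) u)"
      by (rule H.translation_equation[OF aH u]) blast
    have wH: "word_prod ?H (letter_val ?H y) u = ?w y \<and> ?w y \<in> H" if "y \<in> tuples k ?H" for y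
      using word_prod_subgroup[OF H(1) that u] H.word_prod_closed[OF H.letter_val_closed[OF that] u]
      by simp
    have iff: "subst_const ?H v y = \<one>\<^bsub>?H\<^esub> \<longleftrightarrow> ?w (\<lambda>i\<in>{..<k}. a i \<otimes> y i) = ?w a"
      if y: "y \<in> tuples k ?H" for y
    proof -
      have ay: "(\<lambda>i\<in>{..<k}. a i \<otimes> y i) \<in> tuples k ?H" using H.mult_tuples[OF aH y] by simp
      have "subst_const ?H v y = ?w (\<lambda>i\<in>{..<k}. a i \<otimes> y i) \<otimes> inv (?w a)"
        using vx[OF y] wH[OF ay] wH[OF aH] H(1) by simp
      moreover have "?w (\<lambda>i\<in>{..<k}. a i \<otimes> y i) \<in> carrier G" "?w a \<in> carrier G"
        using wH[OF ay] wH[OF aH] subgroup.mem_carrier[OF H(1)] by auto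
      ultimately show ?thesis by (auto simp: inv_solve_right')
    qed
    \<comment> \<open>The equation \<open>v\<close> holds on the smaller box, which lies in
      \<open>Y\<close>, so minimality forces it on all of \<open>Y\<close>.\<close>
    have "({..<k} \<rightarrow>\<^sub>E H \<inter> U) \<subseteq> Y" unfolding U0(2) using U(2) by (intro PiE_mono) auto
    moreover have "\<forall>y\<in>{..<k} \<rightarrow>\<^sub>E H \<inter> U. subst_const ?H v y = \<one>\<^bsub>?H\<^esub>"
      using const iff sub by blast
    ultimately have "subst_const ?H v x = \<one>\<^bsub>?H\<^esub>"
      using min U(1) v x unfolding U0(2) by blast
    then show "?w (\<lambda>i\<in>{..<k}. a i \<otimes> x i) = ?w a" using iff x sub by blast
  qed
qed

end

section \<open>Continuity of word maps and local constancy\<close>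

context topological_group
begin

lemma continuous_map_mult:
  assumes "continuous_map X T f" "continuous_map X T g"
  shows "continuous_map X T (\<lambda>x. f x \<otimes> g x)"
proof -
  have "continuous_map X (prod_topology T T) (\<lambda>x. (f x, g x))"
    using assms by (simp add: continuous_map_paired)
  from continuous_map_compose[OF this continuous_mult] show ?thesis by (simp add: o_def)
qed

lemma continuous_map_inv:
  "continuous_map X T f \<Longrightarrow> continuous_map X T (\<lambda>x. inv (f x))"
  using continuous_map_compose[OF _ continuous_inv] by (simp add: o_def)

lemma continuous_map_word_prod:
  assumes "u \<in> lists (free_letters k)"
  shows "continuous_map (product_topology (\<lambda>_. T) {..<k}) T (\<lambda>g. word_prod G (letter_val G g) u)"
  using assms
proof (induction u)
  case Nil
  then show ?case by (simp add: topspace_eq)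
next
  case (Cons l u)
  have "continuous_map (product_topology (\<lambda>_. T) {..<k}) T (\<lambda>g. g (fst l))"
    using Cons(1) by (intro continuous_map_product_projection) (auto simp: free_letters_def)
  then have "continuous_map (product_topology (\<lambda>_. T) {..<k}) T (\<lambda>g. letter_val G g l)"
    using continuous_map_inv by (cases l; cases "snd l") (auto simp: letter_val_def)
  with Cons show ?case by (simp add: continuous_map_mult)
qed

lemma continuous_map_translation:
  assumes "a \<in> tuples k G"
  shows "continuous_map (product_topology (\<lambda>_. T) {..<k}) (product_topology (\<lambda>_. T) {..<k})
    (\<lambda>x. \<lambda>i\<in>{..<k}. a i \<otimes> x i)"
proof (rule continuous_map_coordinatewise_then_product)
  fix i assume i: "i \<in> {..<k}"
  have "continuous_map (product_topology (\<lambda>_. T) {..<k}) T (\<lambda>x. a i \<otimes> x i)"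
    using i PiE_mem[OF assms i]
    by (intro continuous_map_mult continuous_map_product_projection) (simp_all add: topspace_eq)
  then show "continuous_map (product_topology (\<lambda>_. T) {..<k}) T (\<lambda>x. (\<lambda>i\<in>{..<k}. a i \<otimes> x i) i)"
    using i by simp
qed auto

lemma finite_word_values:
  assumes T: "compact_space T" "Hausdorff_space T"
    and w: "w \<in> carrier (free_group k)"
    and small: "word_values G k w \<prec> Pow (UNIV :: nat set)"
    and H: "subgroup H G" "equationally_noetherian (G\<lparr>carrier := H\<rparr>)"
    and dense: "T closure_of H = topspace T"
  shows "finite (word_values G k w)"
proof -
  let ?P = "product_topology (\<lambda>_. T) {..<k}"
  obtain u where u: "u \<in> lists (free_letters k)"
      "w = word_cong (free_letters k) (free_rels k) `` {u}"
    using w unfolding free_group_def by (rule presented_carrierE)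
  define f where "f = (\<lambda>g. word_prod G (letter_val G g) u)"
  have f: "continuous_map ?P T f" unfolding f_def by (rule continuous_map_word_prod[OF u(1)])
  have topP: "topspace ?P = tuples k G" by (simp add: topspace_eq)
  have vals: "word_values G k w = f ` topspace ?P"
    unfolding word_values_def topP u(2) f_def
    by (rule image_cong) (simp_all add: subst_word_class u(1))
  have compP: "compact_space ?P" using T(1) by (simp add: compact_space_product_topology)
  have HausP: "Hausdorff_space ?P" using T(2) by (simp add: Hausdorff_space_product_topology)
  \<comment> \<open>The closure of a product is the product of the closures, so density passes to
    powers.\<close>
  have denseP: "\<exists>h \<in> {..<k} \<rightarrow>\<^sub>E H. h \<in> V" if "openin ?P V" "V \<noteq> {}" for V
  proof -
    have "?P closure_of ({..<k} \<rightarrow>\<^sub>E H) = topspace ?P"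
      by (simp add: closure_of_product_topology dense)
    then show ?thesis using that unfolding dense_intersects_open by blast
  qed
  have HG: "H \<subseteq> carrier G" by (rule subgroup.subset[OF H(1)])
  define \<U> where "\<U> = {U. openin T U \<and> \<one> \<in> U}"
  have "carrier G \<in> \<U>" by (simp add: \<U>_def flip: topspace_eq) (simp add: topspace_eq)
  then have "\<U> \<noteq> {}" by blast
  obtain U\<^sub>0 where "U\<^sub>0 \<in> \<U>"
    and box: "\<And>U a x. \<lbrakk>U \<in> \<U>; U \<subseteq> U\<^sub>0; a \<in> {..<k} \<rightarrow>\<^sub>E H;
      \<forall>y \<in> {..<k} \<rightarrow>\<^sub>E H \<inter> U. f (\<lambda>i\<in>{..<k}. a i \<otimes> y i) = f a;
      x \<in> {..<k} \<rightarrow>\<^sub>E H \<inter> U\<^sub>0\<rbrakk> \<Longrightarrow> f (\<lambda>i\<in>{..<k}. a i \<otimes> x i) = f a"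
    unfolding f_def by (rule noetherian_box[OF H \<open>\<U> \<noteq> {}\<close> u(1)]) blast
  then have U\<^sub>0: "openin T U\<^sub>0" "\<one> \<in> U\<^sub>0" by (simp_all add: \<U>_def)
  have open_box: "openin ?P (\<Pi>\<^sub>E i\<in>{..<k}. {x \<in> topspace T. c i x \<in> U\<^sub>0})"
    if "\<And>i. i < k \<Longrightarrow> continuous_map T T (c i)" for c
    using that U\<^sub>0(1) by (auto simp: openin_PiE intro!: openin_continuous_map_preimage)
  show ?thesis unfolding vals
  proof (rule finite_image_if_locally_constant[OF compP])
    fix b assume "b \<in> topspace ?P"
    then have b: "b \<in> tuples k G" by (simp only: topP)
    have bi: "b i \<in> carrier G" if "i < k" for i using PiE_mem[OF b] that by simp
    \<comment> \<open>Chosen so that any later \<open>a\<close> in \<open>W\<close> has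
      \<open>b\<close> in its translate of the box over \<open>U\<^sub>0\<close>; the point
      \<open>a\<close> can then move freely in search of an open set on which \<open>f\<close> is
      constant.\<close>
    define W where "W = (\<Pi>\<^sub>E i\<in>{..<k}. {x \<in> topspace T. inv x \<otimes> b i \<in> U\<^sub>0})"
    have "openin ?P W"
      unfolding W_def using bi
      by (intro open_box continuous_map_mult continuous_map_inv) (simp_all add: topspace_eq)
    moreover have "b \<in> W" using b bi U\<^sub>0(2) by (auto simp: W_def PiE_iff topspace_eq)
    ultimately obtain V p where V: "openin ?P V" "V \<noteq> {}" "V \<subseteq> W" "\<And>x. x \<in> V \<Longrightarrow> f x = p"
      using constant_on_open_subset[OF compP HausP T(2) f small[unfolded vals]] by blast
    obtain a where a: "a \<in> {..<k} \<rightarrow>\<^sub>E H" "a \<in> V" using denseP[OF V(1,2)] by blast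
    have aG: "a \<in> tuples k G" using a(1) HG by (auto simp: PiE_iff)
    have ai: "a i \<in> carrier G" if "i < k" for i using PiE_mem[OF aG] that by simp
    obtain B where B: "\<And>i. i < k \<Longrightarrow> openin T (B i)" "a \<in> Pi\<^sub>E {..<k} B" "Pi\<^sub>E {..<k} B \<subseteq> V"
    proof -
      have "\<exists>B. finite {i \<in> {..<k}. B i \<noteq> topspace T} \<and> (\<forall>i\<in>{..<k}. openin T (B i))
          \<and> a \<in> Pi\<^sub>E {..<k} B \<and> Pi\<^sub>E {..<k} B \<subseteq> V"
        using V(1) a(2) unfolding openin_product_topology_alt by (rule bspec)
      then show thesis using that by auto
    qed
    \<comment> \<open>Translating the box over \<open>U\<close> by \<open>a\<close> lands in
      \<open>V\<close>, where \<open>f\<close> is constant. The factor \<open>topspace T\<close>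
      keeps the indexed intersection open also when \<open>k = 0\<close>.\<close>
    define U where "U = U\<^sub>0 \<inter> ((\<Inter>i\<in>{..<k}. {x \<in> topspace T. a i \<otimes> x \<in> B i}) \<inter> topspace T)"
    have "openin T {x \<in> topspace T. a i \<otimes> x \<in> B i}" if "i < k" for i
    proof (rule openin_continuous_map_preimage)
      show "continuous_map T T (\<lambda>x. a i \<otimes> x)"
        using ai[OF that] by (intro continuous_map_mult) (simp_all add: topspace_eq)
    qed (rule B(1)[OF that])
    then have "openin T U" unfolding U_def using U\<^sub>0(1) by (intro openin_Int openin_INT) auto
    moreover have "\<one> \<in> U" using U\<^sub>0(2) ai B(2) by (auto simp: U_def topspace_eq PiE_iff)
    moreover have "U \<subseteq> U\<^sub>0" by (simp add: U_def)
    moreover have "\<forall>y \<in> {..<k} \<rightarrow>\<^sub>E H \<inter> U. f (\<lambda>i\<in>{..<k}. a i \<otimes> y i) = f a"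
    proof
      fix y assume "y \<in> {..<k} \<rightarrow>\<^sub>E H \<inter> U"
      then have "(\<lambda>i\<in>{..<k}. a i \<otimes> y i) \<in> Pi\<^sub>E {..<k} B" by (auto simp: U_def PiE_iff)
      then show "f (\<lambda>i\<in>{..<k}. a i \<otimes> y i) = f a"
        using B(3) V(4) a(2) by (metis subsetD)
    qed
    ultimately have const: "f (\<lambda>i\<in>{..<k}. a i \<otimes> x i) = f a" if "x \<in> {..<k} \<rightarrow>\<^sub>E H \<inter> U\<^sub>0" for x
      using box[of U a x] a(1) that by (simp add: \<U>_def)
    \<comment> \<open>An equalizer of maps into a Hausdorff space, hence closed. It contains the
      points of \<open>H\<close> in the box over \<open>U\<^sub>0\<close>; if it missed a point of
      that open box, density would give a point of \<open>H\<close> in the open difference.\<close>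
    define E where "E = {x \<in> topspace ?P. f (\<lambda>i\<in>{..<k}. a i \<otimes> x i) = f a}"
    have "continuous_map ?P T (\<lambda>x. f (\<lambda>i\<in>{..<k}. a i \<otimes> x i))"
      using continuous_map_compose[OF continuous_map_translation[OF aG] f] by (simp add: o_def)
    moreover have "f a \<in> topspace T"
      using continuous_map_image_subset_topspace[OF f] aG topP by blast
    ultimately have "closedin ?P E"
      unfolding E_def using T(2) by (intro closedin_continuous_maps_eq) auto
    moreover have box_open: "openin ?P ({..<k} \<rightarrow>\<^sub>E U\<^sub>0)" using U\<^sub>0(1) by (simp add: openin_PiE)
    ultimately have diff: "openin ?P (({..<k} \<rightarrow>\<^sub>E U\<^sub>0) - E)" by (simp add: openin_diff)
    have HE: "x \<in> E" if "x \<in> {..<k} \<rightarrow>\<^sub>E H" "x \<in> {..<k} \<rightarrow>\<^sub>E U\<^sub>0" for x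
      using that const[of x] openin_subset[OF U\<^sub>0(1)] unfolding E_def by (auto simp: PiE_iff)
    have E: "({..<k} \<rightarrow>\<^sub>E U\<^sub>0) \<subseteq> E"
    proof (rule ccontr)
      assume "\<not> ({..<k} \<rightarrow>\<^sub>E U\<^sub>0) \<subseteq> E"
      then have "({..<k} \<rightarrow>\<^sub>E U\<^sub>0) - E \<noteq> {}" by (simp only: Diff_eq_empty_iff not_False_eq_True)
      then obtain h where "h \<in> {..<k} \<rightarrow>\<^sub>E H" "h \<in> ({..<k} \<rightarrow>\<^sub>E U\<^sub>0) - E"
        using denseP[OF diff] by metis
      then show False using HE by (metis DiffE)
    qed
    \<comment> \<open>The translate by \<open>a\<close> of the box over \<open>U\<^sub>0\<close>: a
      neighbourhood of \<open>b\<close> by the choice of \<open>W\<close>. There \<open>f\<close>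
      has the constant value \<open>f a\<close>, which is therefore also \<open>f b\<close>.\<close>
    define N where "N = (\<Pi>\<^sub>E i\<in>{..<k}. {x \<in> topspace T. inv (a i) \<otimes> x \<in> U\<^sub>0})"
    have "openin ?P N"
      unfolding N_def using ai by (intro open_box continuous_map_mult) (simp_all add: topspace_eq)
    moreover have "b \<in> N"
      using a(2) V(3) b by (auto simp: N_def W_def PiE_iff topspace_eq)
    moreover have "f y = f a" if y: "y \<in> N" for y
    proof -
      let ?x = "\<lambda>i\<in>{..<k}. inv (a i) \<otimes> y i"
      have "?x \<in> {..<k} \<rightarrow>\<^sub>E U\<^sub>0" using y by (auto simp: N_def PiE_iff)
      then have "f (\<lambda>i\<in>{..<k}. a i \<otimes> ?x i) = f a" using E unfolding E_def by blast
      moreover have "(\<lambda>i\<in>{..<k}. a i \<otimes> ?x i) = y"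
      proof
        fix i show "(\<lambda>i\<in>{..<k}. a i \<otimes> ?x i) i = y i"
          using y ai[of i] by (auto simp: N_def PiE_iff extensional_def topspace_eq simp flip: m_assoc)
      qed
      ultimately show ?thesis by simp
    qed
    ultimately show "\<exists>V. openin ?P V \<and> b \<in> V \<and> (\<forall>y\<in>V. f y = f b)" by metis
  qed
qed

end

theorem theorem1p1:
  fixes G :: "('a, 'm) monoid_scheme" and T :: "'a topology"
    and k :: nat and w :: "(nat \<times> bool) list set" and H :: "'a set"
  assumes "profinite_group G T"
    and "w \<in> carrier (free_group k)"
    and "word_values G k w \<prec> Pow (UNIV :: nat set)"
    and "subgroup H G"
    and "equationally_noetherian (G\<lparr>carrier := H\<rparr>)"
    and "T closure_of H = topspace T"
  shows "finite (word_values G k w)"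
proof -
  interpret profinite_group G T by (rule assms(1))
  show ?thesis by (rule finite_word_values[OF compact Hausdorff assms(2-6)])
qed

end
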